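(* Suppose there exist constants $M>0$ and $\nu>0$ such that $f,\Psi$ satisfy the curvature condition: for all $x,s\in\mathrm{dom}(\Psi)$ (and $g\in\partial f(x)$ used in $D_f(\cdot,x)$), $$D(x,s,\theta)\le\frac{M\theta^{1+\nu}}{1+\nu}\quad\text{for all }\theta\in[0,1],$$ where $D(x,s,\theta)$ is defined in the context. Suppose the generalized conditional subgradient algorithm described in the context chooses $\theta_k=\frac{1+\nu}{k+1+\nu}$ for $k=0,1,\dots$. Then its iterates satisfy, for $k=1,2,\dots$, $$f(x_k) + \Psi(x_k) + f^*(u_k) + \Psi^*(-u_k) \le M\left(\frac{1+\nu}{k+1+\nu}\right)^\nu.$$
   Context: Setting. $E$ is a real vector space with continuous dual $E^*$ and pairing $\langle\cdot,\cdot\rangle$; $f,\Psi:E\to\mathbb{R}\cup\{\infty\}$ are closed convex functions with $\mathrm{dom}(\Psi)\subseteq\mathrm{dom}(\partial f)$. For a function $\phi$, $\phi^*(v)=\sup_x\{\langle v,x\rangle-\phi(x)\}$ is its convex conjugate. Generalized conditional subgradient algorithm. Input $x_0\in\mathrm{dom}(\Psi)$. For $k=0,1,2,\dots$: pick $g_k\in\partial f(x_k)$; pick $s_k\in\mathrm{argmin}_s\{\langle g_k,s\rangle+\Psi(s)\}$; pick $\theta_k\in[0,1]$; let $x_{k+1}=(1-\theta_k)x_k+\theta_ks_k$. It is assumed that at each iteration the minimizer $s_k$ exists, and that $\theta_0=1$ and $\theta_k\in(0,1)$ for $k\ge1$. Dual averages. Let $t_k>0$, $k=0,1,\dots$, be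 such that $\theta_k=t_k/\sum_{i=0}^kt_i$ for all $k$ (these are determined by $(\theta_k)$ up to a common positive factor), and for $k\ge1$ let $u_k=\sum_{i=0}^{k-1}t_ig_i/\sum_{i=0}^{k-1}t_i$; equivalently $u_1=g_0$ and $u_{k+1}=(1-\theta_k)u_k+\theta_kg_k$. Definition of $D$. For $x,s\in\mathrm{dom}(\Psi)$ and $\theta\in[0,1]$, $$D(x,s,\theta)=D_f(x+\theta(s-x),x)+\Psi(x+\theta(s-x))-(1-\theta)\Psi(x)-\theta\Psi(s),$$ where $D_f(y,x)=f(y)-f(x)-\langle g,y-x\rangle$ with $g\in\partial f(x)$; the curvature condition is understood for every $g\in\partial f(x)$. *)

theory Defs
  imports "HOL-Analysis.Analysis"
begin

text \<open>Real topological vector spaces; no separation, local convexity or dimension assumption.\<close>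

class real_tvs = real_vector + topological_ab_group_add +
  assumes tendsto_scaleR_Pair:
    "LIM p (nhds (c::real) \<times>\<^sub>F nhds b). fst p *\<^sub>R snd p :> nhds (c *\<^sub>R b)"

instance real_normed_vector \<subseteq> real_tvs
proof
  fix c :: real and b :: 'a
  show "LIM p (nhds c \<times>\<^sub>F nhds b). fst p *\<^sub>R snd p :> nhds (c *\<^sub>R b)"
    by (intro tendsto_scaleR filterlim_fst filterlim_snd)
qed

text \<open>The elements of the continuous dual are plain functions, so that the pairing of \<open>v\<close> and
  \<open>x\<close> is application \<open>v x\<close>, and sums, scalings and negatives of functionals are pointwise.\<close>

definition cdual :: "('a::real_tvs \<Rightarrow> real) set" where
  "cdual = {v. linear v \<and> continuous_on UNIV v}"

definition edom :: "('a \<Rightarrow> ereal) \<Rightarrow> 'a set" where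
  "edom \<phi> = {x. \<phi> x < \<infinity>}"

definition ext_epigraph :: "('a \<Rightarrow> ereal) \<Rightarrow> ('a \<times> real) set" where
  "ext_epigraph \<phi> = {p. \<phi> (fst p) \<le> ereal (snd p)}"

text \<open>Properness is not required: the function constantly \<open>\<infinity>\<close> qualifies.\<close>

definition closed_convex_fun :: "('a::real_tvs \<Rightarrow> ereal) \<Rightarrow> bool" where
  "closed_convex_fun \<phi> \<longleftrightarrow>
     (\<forall>x. \<phi> x \<noteq> -\<infinity>) \<and> closed (ext_epigraph \<phi>) \<and> convex (ext_epigraph \<phi>)"

text \<open>Empty outside the domain of \<open>\<phi>\<close>.\<close>

definition subdifferential :: "('a::real_tvs \<Rightarrow> ereal) \<Rightarrow> 'a \<Rightarrow> ('a \<Rightarrow> real) set" where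
  "subdifferential \<phi> x =
     {g \<in> cdual. x \<in> edom \<phi> \<and> (\<forall>y. \<phi> x + ereal (g (y - x)) \<le> \<phi> y)}"

definition convex_conjugate :: "('a \<Rightarrow> ereal) \<Rightarrow> ('a \<Rightarrow> real) \<Rightarrow> ereal" where
  "convex_conjugate \<phi> v = (SUP x. ereal (v x) - \<phi> x)"

definition bregman :: "('a::real_vector \<Rightarrow> ereal) \<Rightarrow> ('a \<Rightarrow> real) \<Rightarrow> 'a \<Rightarrow> 'a \<Rightarrow> ereal" where
  "bregman f g y x = f y - f x - ereal (g (y - x))"

text \<open>The choice of \<open>g\<close> in the subdifferential of \<open>f\<close> at \<open>x\<close> is an explicit argument. For \<open>x\<close>, \<open>s\<close>
  in the domain of \<open>\<Psi>\<close>, and that domain contained in the domain of \<open>f\<close>, all terms are finite,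
  so no undefined sum of infinities occurs.\<close>

definition curvature_D ::
  "('a::real_vector \<Rightarrow> ereal) \<Rightarrow> ('a \<Rightarrow> ereal) \<Rightarrow> ('a \<Rightarrow> real) \<Rightarrow> 'a \<Rightarrow> 'a \<Rightarrow> real \<Rightarrow> ereal" where
  "curvature_D f \<Psi> g x s \<theta> =
     bregman f g (x + \<theta> *\<^sub>R (s - x)) x + \<Psi> (x + \<theta> *\<^sub>R (s - x))
       - ereal (1 - \<theta>) * \<Psi> x - ereal \<theta> * \<Psi> s"

definition curvature_condition ::
  "('a::real_tvs \<Rightarrow> ereal) \<Rightarrow> ('a \<Rightarrow> ereal) \<Rightarrow> real \<Rightarrow> real \<Rightarrow> bool" where
  "curvature_condition f \<Psi> M \<nu> \<longleftrightarrow>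
     (\<forall>x \<in> edom \<Psi>. \<forall>s \<in> edom \<Psi>. \<forall>g \<in> subdifferential f x. \<forall>\<theta> \<in> {0..1}.
        curvature_D f \<Psi> g x s \<theta> \<le> ereal (M * \<theta> powr (1 + \<nu>) / (1 + \<nu>)))"

definition gen_cond_subgradient ::
  "('a::real_tvs \<Rightarrow> ereal) \<Rightarrow> ('a \<Rightarrow> ereal) \<Rightarrow> (nat \<Rightarrow> 'a) \<Rightarrow> (nat \<Rightarrow> 'a \<Rightarrow> real) \<Rightarrow>
    (nat \<Rightarrow> 'a) \<Rightarrow> (nat \<Rightarrow> real) \<Rightarrow> bool" where
  "gen_cond_subgradient f \<Psi> x g s \<theta> \<longleftrightarrow>
     x 0 \<in> edom \<Psi> \<and>
     \<theta> 0 = 1 \<and> (\<forall>k\<ge>1. \<theta> k \<in> {0<..<1}) \<and>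
     (\<forall>k. g k \<in> subdifferential f (x k) \<and>
          is_arg_min (\<lambda>z. ereal (g k z) + \<Psi> z) (\<lambda>_. True) (s k) \<and>
          x (Suc k) = (1 - \<theta> k) *\<^sub>R x k + \<theta> k *\<^sub>R s k)"

definition dual_average :: "(nat \<Rightarrow> real) \<Rightarrow> (nat \<Rightarrow> 'a \<Rightarrow> real) \<Rightarrow> nat \<Rightarrow> 'a \<Rightarrow> real" where
  "dual_average t g k = (\<lambda>z. (\<Sum>i<k. t i * g i z) / (\<Sum>i<k. t i))"

end

theory Submission
  imports Defs
begin

text \<open>The left-hand side is a duality gap, and the reason for the rate is that this gap satisfies
  a scalar recursion. Write \<open>h k\<close> for the gap with the two conjugate terms
  replaced by upper bounds. Since \<open>g k\<close> is a subgradient of \<open>f\<close> at \<open>x k\<close>, the conjugate \<open>f\<^sup>*\<close> at \<open>g k\<close>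
  is at most \<open>g k (x k) - f (x k)\<close>; since \<open>s k\<close> minimizes \<open>g k + \<Psi>\<close>, the conjugate \<open>\<Psi>\<^sup>*\<close> at
  \<open>- g k\<close> is at most \<open>- g k (s k) - \<Psi> (s k)\<close>. Conjugates are convex, so at the dual average they
  are bounded by the averages of these numbers with the weights \<open>t\<close>
  (\<open>convex_conjugate_dual_average_le\<close>), and these averages are updated by the same convex
  combination, with weight \<open>\<theta> k\<close>, as the iterates (\<open>weighted_average_Suc\<close>).

  The curvature condition bounds the new primal value by
  \<open>f (x k) + (1 - \<theta> k) * \<Psi> (x k) + \<theta> k * \<Psi> (s k) + \<theta> k * g k (s k - x k)\<close> plus the curvature
  error (\<open>curvature_step\<close>). The dual update contributes the same terms in \<open>s k\<close> and \<open>g k\<close> with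
  opposite sign, and \<open>- \<theta> k * f (x k)\<close>, so after cancellation
  \<open>h (k + 1) \<le> (1 - \<theta> k) * h k + M * \<theta> k powr (1 + \<nu>) / (1 + \<nu>)\<close>.
  For the step sizes \<open>\<theta> k = (1 + \<nu>) / (k + 1 + \<nu>)\<close> the bound \<open>h k \<le> M * \<theta> k powr \<nu>\<close> is propagated by
  this recursion because \<open>1 - \<nu> / n \<le> (n / (n + 1)) powr \<nu>\<close> (\<open>step_size_recursion\<close>); as
  \<open>\<theta> 0 = 1\<close>, the recursion forgets \<open>h 0\<close>, and the same inequality at \<open>n = 1 + \<nu>\<close> starts the
  induction at \<open>h 1\<close>.\<close>

section \<open>The scalar recursion\<close>

text \<open>Both sides are compared with \<open>exp (- \<nu> / n)\<close>, using \<open>1 + y \<le> exp y\<close> once for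
  \<open>y = - \<nu> / n\<close> and once for \<open>y = 1 / n\<close>.\<close>

lemma one_minus_divide_le_powr:
  fixes n \<nu> :: real
  assumes "n > 0" "\<nu> \<ge> 0"
  shows "1 - \<nu> / n \<le> (n / (n + 1)) powr \<nu>"
proof -
  have "ln (1 + 1 / n) \<le> 1 / n"
    using assms by (intro ln_add_one_self_le_self) simp
  moreover have "ln (n / (n + 1)) = - ln (1 + 1 / n)"
  proof -
    have "n / (n + 1) = inverse (1 + 1 / n)"
      using assms by (simp add: field_simps)
    then show ?thesis using assms by (simp add: ln_inverse)
  qed
  ultimately have "- \<nu> / n \<le> \<nu> * ln (n / (n + 1))"
    using mult_left_mono[of "ln (1 + 1 / n)" "1 / n" \<nu>] assms by simp
  then have "exp (- \<nu> / n) \<le> (n / (n + 1)) powr \<nu>"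
    using assms by (simp add: powr_def)
  moreover have "1 - \<nu> / n \<le> exp (- \<nu> / n)"
    using exp_ge_add_one_self[of "- \<nu> / n"] by simp
  ultimately show ?thesis by linarith
qed

text \<open>Inserting \<open>h k = M * \<theta> k powr \<nu>\<close> on the right of the recursion gives
  \<open>M * \<theta> k powr \<nu> * (1 - \<nu> / n)\<close> with \<open>n = k + 1 + \<nu>\<close>, and \<open>\<theta> (k + 1) = \<theta> k * (n / (n + 1))\<close>, so
  the previous inequality is precisely what makes this bound invariant.\<close>

lemma step_size_recursion:
  fixes h \<theta> :: "nat \<Rightarrow> real" and M \<nu> :: real
  assumes "M \<ge> 0" "\<nu> > 0"
    and \<theta>: "\<And>k. \<theta> k = (1 + \<nu>) / (real k + 1 + \<nu>)"
    and h: "\<And>k. h (Suc k) \<le> (1 - \<theta> k) * h k + M * \<theta> k powr (1 + \<nu>) / (1 + \<nu>)"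
  shows "h (Suc k) \<le> M * \<theta> (Suc k) powr \<nu>"
proof -
  have propagate: "(1 - \<theta> k) * (M * \<theta> k powr \<nu>) + M * \<theta> k powr (1 + \<nu>) / (1 + \<nu>)
      \<le> M * \<theta> (Suc k) powr \<nu>" for k
  proof -
    define n where "n = real k + 1 + \<nu>"
    have n: "n > 0" and \<theta>n: "\<theta> k = (1 + \<nu>) / n"
      using assms by (auto simp: n_def)
    have \<theta>_pos: "\<theta> k > 0" using n \<open>\<nu> > 0\<close> by (simp add: \<theta>n)
    have "(1 - \<theta> k) * (M * \<theta> k powr \<nu>) + M * \<theta> k powr (1 + \<nu>) / (1 + \<nu>)
        = M * \<theta> k powr \<nu> * (1 - \<theta> k + \<theta> k / (1 + \<nu>))"
      using \<theta>_pos by (simp add: powr_add algebra_simps)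
    also have "1 - \<theta> k + \<theta> k / (1 + \<nu>) = 1 - \<nu> / n"
      using n \<open>\<nu> > 0\<close> by (simp add: \<theta>n divide_simps)
    also have "M * \<theta> k powr \<nu> * (1 - \<nu> / n) \<le> M * \<theta> k powr \<nu> * (n / (n + 1)) powr \<nu>"
      using one_minus_divide_le_powr[OF n, of \<nu>] assms by (intro mult_left_mono) auto
    also have "\<dots> = M * (\<theta> k * (n / (n + 1))) powr \<nu>"
      using n \<theta>_pos by (subst powr_mult) (auto simp: mult.assoc)
    also have "\<theta> k * (n / (n + 1)) = \<theta> (Suc k)"
      using n unfolding \<theta>[of "Suc k"] by (simp add: \<theta>n) (simp add: n_def algebra_simps)
    finally show ?thesis .
  qed
  have "\<theta> 0 = 1" using \<open>\<nu> > 0\<close> by (simp add: \<theta>)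
  have "\<theta> k \<le> 1" for k using \<open>\<nu> > 0\<close> by (simp add: \<theta>)
  show ?thesis
  proof (induction k)
    case 0
    show ?case using h[of 0] propagate[of 0] \<open>\<theta> 0 = 1\<close> by simp
  next
    case (Suc k)
    show ?case
      using h[of "Suc k"] propagate[of "Suc k"] \<open>\<theta> (Suc k) \<le> 1\<close>
        mult_left_mono[OF Suc, of "1 - \<theta> (Suc k)"] by simp
  qed
qed

section \<open>Weighted averages and conjugates\<close>

text \<open>For \<open>k = 0\<close> the average over the empty index set is \<open>0 / 0 = 0\<close>, which is harmless since its
  coefficient \<open>1 - \<theta>\<close> vanishes.\<close>

lemma weighted_average_Suc:
  fixes t c :: "nat \<Rightarrow> real"
  assumes "\<And>k. t k > 0" and \<theta>: "\<theta> = t k / (\<Sum>i\<le>k. t i)"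
  shows "(\<Sum>i<Suc k. t i * c i) / (\<Sum>i<Suc k. t i)
    = (1 - \<theta>) * ((\<Sum>i<k. t i * c i) / (\<Sum>i<k. t i)) + \<theta> * c k"
proof (cases "k = 0")
  case True
  then show ?thesis using assms(1)[of 0] by (simp add: \<theta>)
next
  case False
  have T: "(\<Sum>i<k. t i) > 0"
    using False assms(1) by (intro sum_pos) auto
  then have T': "(\<Sum>i<k. t i) + t k > 0" using assms(1)[of k] by simp
  have "1 - \<theta> = (\<Sum>i<k. t i) / ((\<Sum>i<k. t i) + t k)"
    using T' by (simp add: \<theta> lessThan_Suc_atMost[symmetric] field_simps)
  then show ?thesis
    using T T' by (simp add: \<theta> lessThan_Suc_atMost[symmetric] add_divide_distrib)
qed

lemma convex_conjugate_le_iff: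
  fixes \<phi> :: "'a \<Rightarrow> ereal"
  assumes "\<And>z. \<phi> z \<noteq> -\<infinity>"
  shows "convex_conjugate \<phi> v \<le> ereal c \<longleftrightarrow> (\<forall>z\<in>edom \<phi>. v z - c \<le> real_of_ereal (\<phi> z))"
proof -
  have "ereal (v z) - \<phi> z \<le> ereal c \<longleftrightarrow> (z \<in> edom \<phi> \<longrightarrow> v z - c \<le> real_of_ereal (\<phi> z))" for z
    using assms[of z] by (cases "\<phi> z") (auto simp: edom_def algebra_simps)
  then show ?thesis by (auto simp: convex_conjugate_def SUP_le_iff)
qed

text \<open>This is Jensen's inequality for the conjugate, which is convex as a supremum of affine
  functions of \<open>v\<close>. The requirement \<open>k \<ge> 1\<close> ensures that the weights have a positive sum.\<close>

lemma convex_conjugate_dual_average_le: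
  fixes \<phi> :: "'a \<Rightarrow> ereal"
  assumes \<phi>: "\<And>z. \<phi> z \<noteq> -\<infinity>" and t: "\<And>i. t i > 0" and "k \<ge> 1"
    and v: "\<And>i. convex_conjugate \<phi> (v i) \<le> ereal (c i)"
  shows "convex_conjugate \<phi> (dual_average t v k)
    \<le> ereal ((\<Sum>i<k. t i * c i) / (\<Sum>i<k. t i))"
  unfolding convex_conjugate_le_iff[OF \<phi>]
proof
  fix z assume z: "z \<in> edom \<phi>"
  let ?T = "\<Sum>i<k. t i" and ?r = "real_of_ereal (\<phi> z)"
  have T: "?T > 0" using \<open>k \<ge> 1\<close> t by (intro sum_pos) (auto simp: lessThan_empty_iff)
  have "v i z - c i \<le> ?r" for i
    using v[of i] z unfolding convex_conjugate_le_iff[OF \<phi>] by blast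
  then have "(\<Sum>i<k. t i * (v i z - c i)) \<le> (\<Sum>i<k. t i * ?r)"
    using t by (intro sum_mono mult_left_mono) (auto intro: less_imp_le)
  then have "(\<Sum>i<k. t i * v i z) - (\<Sum>i<k. t i * c i) \<le> ?T * ?r"
    by (simp add: right_diff_distrib sum_subtractf sum_distrib_right)
  then show "dual_average t v k z - (\<Sum>i<k. t i * c i) / ?T \<le> ?r"
    using T by (simp add: dual_average_def diff_divide_distrib[symmetric] pos_divide_le_eq mult.commute)
qed

text \<open>One half of the Fenchel--Young equality.\<close>

lemma convex_conjugate_subgradient_le:
  assumes \<phi>: "\<And>z. \<phi> z \<noteq> -\<infinity>" and g: "g \<in> subdifferential \<phi> x"
  shows "convex_conjugate \<phi> g \<le> ereal (g x - real_of_ereal (\<phi> x))"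
  unfolding convex_conjugate_le_iff[OF \<phi>]
proof
  fix z assume z: "z \<in> edom \<phi>"
  have lin: "linear g" and x: "x \<in> edom \<phi>" and le: "\<phi> x + ereal (g (z - x)) \<le> \<phi> z"
    using g by (auto simp: subdifferential_def cdual_def)
  show "g z - (g x - real_of_ereal (\<phi> x)) \<le> real_of_ereal (\<phi> z)"
    using le x z \<phi>[of x] \<phi>[of z] linear_diff[OF lin, of z x]
    by (cases "\<phi> x"; cases "\<phi> z") (auto simp: edom_def)
qed

lemma convex_conjugate_uminus_arg_min_le:
  assumes \<phi>: "\<And>z. \<phi> z \<noteq> -\<infinity>" and s: "is_arg_min (\<lambda>z. ereal (g z) + \<phi> z) (\<lambda>_. True) s"
    and "s \<in> edom \<phi>"
  shows "convex_conjugate \<phi> (\<lambda>z. - g z) \<le> ereal (- g s - real_of_ereal (\<phi> s))"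
  unfolding convex_conjugate_le_iff[OF \<phi>]
proof
  fix z assume z: "z \<in> edom \<phi>"
  have "ereal (g s) + \<phi> s \<le> ereal (g z) + \<phi> z"
    using s by (auto simp: is_arg_min_def not_less)
  then show "- g z - (- g s - real_of_ereal (\<phi> s)) \<le> real_of_ereal (\<phi> z)"
    using z \<open>s \<in> edom \<phi>\<close> \<phi>[of s] \<phi>[of z]
    by (cases "\<phi> s"; cases "\<phi> z") (auto simp: edom_def)
qed

section \<open>The iterates\<close>

lemma convex_edom:
  assumes "closed_convex_fun \<phi>"
  shows "convex (edom \<phi>)"
proof (rule convexI)
  fix x y and u v :: real
  assume x: "x \<in> edom \<phi>" and y: "y \<in> edom \<phi>" and uv: "0 \<le> u" "0 \<le> v" "u + v = 1"
  obtain a b where "\<phi> x = ereal a" "\<phi> y = ereal b"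
    using x y assms unfolding edom_def closed_convex_fun_def
    by (metis ereal_cases less_irrefl mem_Collect_eq)
  then have "(x, a) \<in> ext_epigraph \<phi>" "(y, b) \<in> ext_epigraph \<phi>"
    by (auto simp: ext_epigraph_def)
  then have "u *\<^sub>R (x, a) + v *\<^sub>R (y, b) \<in> ext_epigraph \<phi>"
    using assms uv unfolding closed_convex_fun_def convex_def by blast
  then have "\<phi> (u *\<^sub>R x + v *\<^sub>R y) \<le> ereal (u * a + v * b)"
    by (simp add: ext_epigraph_def)
  then show "u *\<^sub>R x + v *\<^sub>R y \<in> edom \<phi>"
    unfolding edom_def by (auto intro: le_less_trans)
qed

lemma arg_min_in_edom:
  assumes "is_arg_min (\<lambda>z. ereal (g z) + \<phi> z) (\<lambda>_. True) s" and "y \<in> edom \<phi>"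
  shows "s \<in> edom \<phi>"
proof -
  have "ereal (g s) + \<phi> s \<le> ereal (g y) + \<phi> y"
    using assms by (auto simp: is_arg_min_def not_less)
  then show ?thesis using assms(2)
    by (cases "\<phi> s"; cases "\<phi> y") (auto simp: edom_def)
qed

lemma gen_cond_subgradient_in_edom:
  assumes "closed_convex_fun \<Psi>" and alg: "gen_cond_subgradient f \<Psi> x g s \<theta>"
  shows "x k \<in> edom \<Psi>" and "s k \<in> edom \<Psi>"
proof -
  have x0: "x 0 \<in> edom \<Psi>" using alg by (simp add: gen_cond_subgradient_def)
  have s: "s k \<in> edom \<Psi>" for k
    using alg x0 arg_min_in_edom unfolding gen_cond_subgradient_def by metis
  then show "s k \<in> edom \<Psi>" .
  have \<theta>: "0 \<le> \<theta> k \<and> \<theta> k \<le> 1" for k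
    using alg by (cases "k = 0") (auto simp: gen_cond_subgradient_def less_imp_le)
  show "x k \<in> edom \<Psi>"
  proof (induction k)
    case (Suc k)
    have "(1 - \<theta> k) *\<^sub>R x k + \<theta> k *\<^sub>R s k \<in> edom \<Psi>"
      using \<theta>[of k] Suc s[of k] by (intro convexD[OF convex_edom[OF assms(1)]]) auto
    then show ?case using alg by (simp add: gen_cond_subgradient_def)
  qed (rule x0)
qed

text \<open>The curvature condition over the reals. All values that occur are finite, so it
  can be solved for the primal value at the new point.\<close>

lemma curvature_step:
  fixes f \<Psi> :: "'a::real_tvs \<Rightarrow> ereal"
  assumes cc: "closed_convex_fun f" "closed_convex_fun \<Psi>"
    and dom: "edom \<Psi> \<subseteq> edom f"
    and curv: "curvature_condition f \<Psi> M \<nu>"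
    and x: "x \<in> edom \<Psi>" and s: "s \<in> edom \<Psi>" and g: "g \<in> subdifferential f x"
    and \<theta>: "\<theta> \<in> {0..1}"
  defines "y \<equiv> (1 - \<theta>) *\<^sub>R x + \<theta> *\<^sub>R s"
  shows "real_of_ereal (f y) + real_of_ereal (\<Psi> y)
    \<le> real_of_ereal (f x) + \<theta> * (g s - g x) + (1 - \<theta>) * real_of_ereal (\<Psi> x)
      + \<theta> * real_of_ereal (\<Psi> s) + M * \<theta> powr (1 + \<nu>) / (1 + \<nu>)"
proof -
  have y: "y = x + \<theta> *\<^sub>R (s - x)" by (simp add: y_def algebra_simps)
  have lin: "linear g" using g by (simp add: subdifferential_def cdual_def)
  have gy: "g (y - x) = \<theta> * (g s - g x)"
    using linear_cmul[OF lin, of \<theta> "s - x"] linear_diff[OF lin, of s x] by (simp add: y)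
  have y_dom: "y \<in> edom \<Psi>"
    unfolding y_def using x s \<theta> by (intro convexD[OF convex_edom[OF cc(2)]]) auto
  have fin: "\<exists>r. \<phi> z = ereal r" if "closed_convex_fun \<phi>" "z \<in> edom \<phi>" for \<phi> :: "'a \<Rightarrow> ereal" and z
    using that by (cases "\<phi> z") (auto simp: closed_convex_fun_def edom_def)
  obtain fx fy px py ps where vals: "f x = ereal fx" "f y = ereal fy" "\<Psi> x = ereal px"
    "\<Psi> y = ereal py" "\<Psi> s = ereal ps"
    using fin cc x s y_dom dom by (meson subsetD)
  have "curvature_D f \<Psi> g x s \<theta> \<le> ereal (M * \<theta> powr (1 + \<nu>) / (1 + \<nu>))"
    using curv x s g \<theta> by (auto simp: curvature_condition_def)
  then show ?thesis
    by (simp add: curvature_D_def bregman_def y[symmetric] gy vals)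
qed

section \<open>The convergence rate\<close>

theorem proposition1:
  fixes f \<Psi> :: "'a::real_tvs \<Rightarrow> ereal"
    and x s :: "nat \<Rightarrow> 'a"
    and g :: "nat \<Rightarrow> 'a \<Rightarrow> real"
    and \<theta> t :: "nat \<Rightarrow> real"
    and M \<nu> :: real
  assumes "closed_convex_fun f" and "closed_convex_fun \<Psi>"
    and "edom \<Psi> \<subseteq> {z. subdifferential f z \<noteq> {}}"
    and "M > 0" and "\<nu> > 0"
    and "curvature_condition f \<Psi> M \<nu>"
    and "gen_cond_subgradient f \<Psi> x g s \<theta>"
    and "\<And>k. \<theta> k = (1 + \<nu>) / (real k + 1 + \<nu>)"
    and "\<And>k. t k > 0" and "\<And>k. \<theta> k = t k / (\<Sum>i\<le>k. t i)"
  shows "\<forall>k\<ge>1. f (x k) + \<Psi> (x k)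
           + convex_conjugate f (dual_average t g k)
           + convex_conjugate \<Psi> (\<lambda>z. - dual_average t g k z)
         \<le> ereal (M * ((1 + \<nu>) / (real k + 1 + \<nu>)) powr \<nu>)"
proof (intro allI impI)
  have dom: "edom \<Psi> \<subseteq> edom f"
    using assms(3) by (auto simp: subdifferential_def)
  have not_minf: "f z \<noteq> -\<infinity>" "\<Psi> z \<noteq> -\<infinity>" for z
    using assms(1,2) by (auto simp: closed_convex_fun_def)
  have in_dom: "x k \<in> edom \<Psi>" "s k \<in> edom \<Psi>" for k
    using gen_cond_subgradient_in_edom[OF assms(2,7)] by auto
  have alg: "g k \<in> subdifferential f (x k)"
    "is_arg_min (\<lambda>z. ereal (g k z) + \<Psi> z) (\<lambda>_. True) (s k)"
    "x (Suc k) = (1 - \<theta> k) *\<^sub>R x k + \<theta> k *\<^sub>R s k" for k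
    using assms(7) by (auto simp: gen_cond_subgradient_def)
  have \<theta>: "\<theta> k \<in> {0..1}" for k
    using assms(5) by (simp add: assms(8))

  define F where "F k = real_of_ereal (f (x k))" for k
  define P where "P k = real_of_ereal (\<Psi> (x k))" for k
  define a where "a k = g k (x k) - F k" for k
  define b where "b k = - g k (s k) - real_of_ereal (\<Psi> (s k))" for k
  define avg where "avg c k = (\<Sum>i<k. t i * c i) / (\<Sum>i<k. t i)" for c :: "nat \<Rightarrow> real" and k
  define h where "h k = F k + P k + avg a k + avg b k" for k

  have avg: "avg c (Suc k) = (1 - \<theta> k) * avg c k + \<theta> k * c k" for c k
    unfolding avg_def by (rule weighted_average_Suc[OF assms(9,10)])
  have "h (Suc k) \<le> (1 - \<theta> k) * h k + M * \<theta> k powr (1 + \<nu>) / (1 + \<nu>)" for k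
  proof -
    have "F (Suc k) + P (Suc k) \<le> F k + \<theta> k * (g k (s k) - g k (x k)) + (1 - \<theta> k) * P k
        + \<theta> k * real_of_ereal (\<Psi> (s k)) + M * \<theta> k powr (1 + \<nu>) / (1 + \<nu>)"
      unfolding F_def P_def alg(3)
      by (rule curvature_step[OF assms(1,2) dom assms(6) in_dom alg(1) \<theta>])
    then show ?thesis
      by (simp add: h_def avg a_def b_def algebra_simps)
  qed
  then have rate: "h (Suc k) \<le> M * \<theta> (Suc k) powr \<nu>" for k
    using step_size_recursion[OF _ assms(5,8)] assms(4) by simp

  fix k :: nat assume k: "k \<ge> 1"
  have f_conj: "convex_conjugate f (dual_average t g k) \<le> ereal (avg a k)"
    unfolding avg_def a_def F_def
    using convex_conjugate_subgradient_le[OF not_minf(1) alg(1)]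
    by (rule convex_conjugate_dual_average_le[OF not_minf(1) assms(9) k])
  have "convex_conjugate \<Psi> (dual_average t (\<lambda>i z. - g i z) k) \<le> ereal (avg b k)"
    unfolding avg_def b_def
    using convex_conjugate_uminus_arg_min_le[OF not_minf(2) alg(2) in_dom(2)]
    by (rule convex_conjugate_dual_average_le[OF not_minf(2) assms(9) k])
  moreover have "dual_average t (\<lambda>i z. - g i z) k = (\<lambda>z. - dual_average t g k z)"
    by (simp add: dual_average_def fun_eq_iff sum_negf)
  ultimately have \<Psi>_conj: "convex_conjugate \<Psi> (\<lambda>z. - dual_average t g k z) \<le> ereal (avg b k)"
    by simp
  have "f (x k) = ereal (F k)" "\<Psi> (x k) = ereal (P k)"
    using in_dom(1)[of k] dom not_minf[of "x k"]
    by (auto simp: F_def P_def edom_def ereal_real)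
  then have "f (x k) + \<Psi> (x k) + convex_conjugate f (dual_average t g k)
      + convex_conjugate \<Psi> (\<lambda>z. - dual_average t g k z) \<le> ereal (h k)"
    using add_mono[OF add_mono[OF order_refl f_conj] \<Psi>_conj, of "ereal (F k + P k)"]
    by (simp add: h_def)
  also have "h k \<le> M * \<theta> k powr \<nu>"
    using rate[of "k - 1"] k by simp
  finally show "f (x k) + \<Psi> (x k) + convex_conjugate f (dual_average t g k)
      + convex_conjugate \<Psi> (\<lambda>z. - dual_average t g k z)
      \<le> ereal (M * ((1 + \<nu>) / (real k + 1 + \<nu>)) powr \<nu>)"
    by (simp add: assms(8))
qed

end
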